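(* Let $n,m,r$ be positive integers with $m,r\le n-1$. If $m=n-1$ or $r=n-1$, then a vertex $(A,P)$ of the contact graph $\mathcal{A}(\overline{D}_m,\overline{D}_r)$ of $\mathsf{IG}(\mathcal{E}_{\mathcal{T}_n})$ is non-regular if and only if it is stationary. Consequently, in such a case (i.e. when $m=n-1$ or $r=n-1$ and $(A,P)$ is non-regular), its vertex group $W_{(A,P)}$ is trivial.
   Context: Conventions: $[1,n]=\{1,\dots,n\}$; maps act on the right and are composed left to right; $\mathcal{T}_n$ is the monoid of all maps $[1,n]\to[1,n]$ and $E(\mathcal{T}_n)$ its set of idempotents. $I_m$ is the set of partitions of $[1,n]$ into $m$ classes, $\Lambda_m$ the set of $m$-element subsets of $[1,n]$. For $A\in\Lambda_m$, $P\in I_m$, $A\perp P$ means that $A$ contains exactly one element of each class of $P$. Free idempotent-generated semigroup: a basic pair is a pair $\{e,f\}$ of idempotents of $\mathcal{T}_n$ with $\{ef,fe\}\cap\{e,f\}\ne\varnothing$. $\mathsf{IG}(\mathcal{E}_{\mathcal{T}_n})$ is the semigroup with generators $\overline{e}$, $e\in E(\mathcal{T}_n)$, and relations $\overline{e}\,\overline{f}=\overline{ef}$ for all basic pairs $\{e,f\}$. $\overline{D}_m$ is its regular $\mathscr{D}$-class containing all $\overline{e}$ with $\mathrm{rank}\,e=m$; its $\mathscr{R}$-classes are indexed by $I_m$ and its $\mathscr{L}$-classes by $\Lambda_m$ ($\overline{e}$ has indices $\ker e$ and $\mathrm{im}\,e$). The principal factor of $\overline{D}_m$ is identified with a Rees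 matrix semigroup over the maximal subgroup $G_m$ of $\overline{D}_m$ whose sandwich matrix has entries $(f^{(m)}_{P,A})^{-1}$ for $A\perp P$ and $0$ otherwise; thus elements of $\overline{D}_m$ are triples $(P,g,A)\in I_m\times G_m\times\Lambda_m$, and the idempotent with indices $P,A$ (for $A\perp P$) is $(P,f^{(m)}_{P,A},A)$. Actions: $\overline{e}\cdot P=Q$ means $\overline{e}(P,g,A)=(Q,h,A)$ for some $g,h,A$; $B\cdot\overline{e}=A$ means $(P,g,B)\overline{e}=(P,h,A)$ for some $P,g,h$. Concretely (known): $B\cdot\overline{e}$ is defined iff $e$ is injective on $B$, and then it equals $Be$; $\overline{e}\cdot P$ is defined iff $\mathrm{im}\,e$ meets every class of $P$, and then its classes are the inverse images under $e$ of the classes of $P$. Contact graph $\mathcal{A}(\overline{D}_m,\overline{D}_r)$: the vertex set is $\Lambda_m\times I_r$. For each $e\in E(\mathcal{T}_n)$ with $A=B\cdot\overline{e}$ and $\overline{e}\cdot P=Q$ there is a directed edge $(A,P)\to(B,Q)$ with group label $(a,b^{-1})\in G_m\times G_r$, where $a=(f^{(m)}_{P_0,A})^{-1}f^{(m)}_{P_0,B}$ for any $P_0\in I_m$ with $\overline{e}\cdot P_0=P_0$, $A\perp P_0$, $B\perp P_0$, and $b=f^{(r)}_{Q,A_0}(f^{(r)}_{P,A_0})^{-1}$ for any $A_0\in\Lambda_r$ with $A_0\cdot\overline{e}=A_0$, $A_0\perp P$, $A_0\perp Q$ (such $P_0,A_0$ exist and the choice is irrelevant). Edges may be traversed backwards,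 with the inverse label. The label of a walk is the product of the labels of its edges in order. The vertex group $W_{(A,P)}\le G_m\times G_r$ is the subgroup of all labels of closed walks based at $(A,P)$. $A$ saturates $P$ if every class of $P$ contains at least one element of $A$; $P$ separates $A$ if every class of $P$ contains at most one element of $A$. The pair $(A,P)$ is regular if $A$ saturates $P$ or $P$ separates $A$; otherwise it is non-regular. $(A,P)$ is stationary if all classes of $P$ containing elements not in $A$ are singletons. *)

theory Defs
  imports "HOL-Algebra.Group" "HOL-Library.FuncSet" "HOL-Library.Disjoint_Sets"
begin

section \<open>Green's relations and maximal subgroups\<close>

text \<open>Principal one-sided ideals are those of the semigroup with an identity adjoined, so
  that the definitions do not depend on the field \<open>one\<close> of the record.\<close>

definition right_ideal :: "('a, 'b) monoid_scheme \<Rightarrow> 'a \<Rightarrow> 'a set" where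
  "right_ideal S x = insert x {x \<otimes>\<^bsub>S\<^esub> s | s. s \<in> carrier S}"

definition left_ideal :: "('a, 'b) monoid_scheme \<Rightarrow> 'a \<Rightarrow> 'a set" where
  "left_ideal S x = insert x {s \<otimes>\<^bsub>S\<^esub> x | s. s \<in> carrier S}"

definition green_R :: "('a, 'b) monoid_scheme \<Rightarrow> ('a \<times> 'a) set" where
  "green_R S = {(x, y) \<in> carrier S \<times> carrier S. right_ideal S x = right_ideal S y}"

definition green_L :: "('a, 'b) monoid_scheme \<Rightarrow> ('a \<times> 'a) set" where
  "green_L S = {(x, y) \<in> carrier S \<times> carrier S. left_ideal S x = left_ideal S y}"

definition green_H :: "('a, 'b) monoid_scheme \<Rightarrow> ('a \<times> 'a) set" where
  "green_H S = green_L S \<inter> green_R S"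

definition green_D :: "('a, 'b) monoid_scheme \<Rightarrow> ('a \<times> 'a) set" where
  "green_D S = green_L S O green_R S"

definition idempotents :: "('a, 'b) monoid_scheme \<Rightarrow> 'a set" where
  "idempotents S = {e \<in> carrier S. e \<otimes>\<^bsub>S\<^esub> e = e}"

text \<open>For an idempotent \<open>i\<close>, the maximal subgroup with identity \<open>i\<close>.\<close>

definition max_subgroup :: "('a, 'b) monoid_scheme \<Rightarrow> 'a \<Rightarrow> 'a monoid" where
  "max_subgroup S i = \<lparr>carrier = green_H S `` {i}, mult = mult S, one = i\<rparr>"


section \<open>Free idempotent-generated semigroups\<close>

definition basic_pair :: "('a, 'b) monoid_scheme \<Rightarrow> 'a \<Rightarrow> 'a \<Rightarrow> bool" where
  "basic_pair S e f \<longleftrightarrow> e \<in> idempotents S \<and> f \<in> idempotents S \<and>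
     {e \<otimes>\<^bsub>S\<^esub> f, f \<otimes>\<^bsub>S\<^esub> e} \<inter> {e, f} \<noteq> {}"

text \<open>The product of a basic pair is again idempotent, so \<open>ig_eq\<close> relates only nonempty
  words over the idempotents.\<close>

definition ig_words :: "('a, 'b) monoid_scheme \<Rightarrow> 'a list set" where
  "ig_words S = {w. w \<noteq> [] \<and> set w \<subseteq> idempotents S}"

inductive ig_eq :: "('a, 'b) monoid_scheme \<Rightarrow> 'a list \<Rightarrow> 'a list \<Rightarrow> bool"
  for S where
  relation: "\<lbrakk>basic_pair S e f; set u \<subseteq> idempotents S; set v \<subseteq> idempotents S\<rbrakk>
    \<Longrightarrow> ig_eq S (u @ [e, f] @ v) (u @ [e \<otimes>\<^bsub>S\<^esub> f] @ v)"
| refl: "w \<in> ig_words S \<Longrightarrow> ig_eq S w w"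
| sym: "ig_eq S u v \<Longrightarrow> ig_eq S v u"
| trans: "\<lbrakk>ig_eq S u v; ig_eq S v w\<rbrakk> \<Longrightarrow> ig_eq S u w"

definition ig_class :: "('a, 'b) monoid_scheme \<Rightarrow> 'a list \<Rightarrow> 'a list set" where
  "ig_class S w = {v. ig_eq S w v}"

text \<open>If \<open>S\<close> is a monoid with identity \<open>1\<close>, then \<open>{e, 1}\<close> is a basic pair for every
  idempotent \<open>e\<close>; hence the generator of \<open>1\<close> is an identity of the semigroup \<open>IG S\<close>.\<close>

definition IG :: "('a, 'b) monoid_scheme \<Rightarrow> 'a list set monoid" where
  "IG S = \<lparr>carrier = ig_class S ` ig_words S,
           mult = (\<lambda>X Y. \<Union>u\<in>X. \<Union>v\<in>Y. ig_class S (u @ v)),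
           one = ig_class S [\<one>\<^bsub>S\<^esub>]\<rparr>"

definition ig_gen :: "('a, 'b) monoid_scheme \<Rightarrow> 'a \<Rightarrow> 'a list set" where
  "ig_gen S e = ig_class S [e]"


section \<open>The full transformation monoid\<close>

text \<open>Maps act on the right and are composed from left to right: \<open>e \<otimes> f\<close> is \<open>e\<close> followed
  by \<open>f\<close>.\<close>

definition full_trans :: "nat \<Rightarrow> (nat \<Rightarrow> nat) monoid" where
  "full_trans n = \<lparr>carrier = {1..n} \<rightarrow>\<^sub>E {1..n},
                   mult = (\<lambda>e f. compose {1..n} f e),
                   one = (\<lambda>x\<in>{1..n}. x)\<rparr>"

definition im :: "nat \<Rightarrow> (nat \<Rightarrow> nat) \<Rightarrow> nat set" where
  "im n e = e ` {1..n}"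

definition ker :: "nat \<Rightarrow> (nat \<Rightarrow> nat) \<Rightarrow> nat set set" where
  "ker n e = {{x \<in> {1..n}. e x = y} | y. y \<in> im n e}"

definition rank :: "nat \<Rightarrow> (nat \<Rightarrow> nat) \<Rightarrow> nat" where
  "rank n e = card (im n e)"

definition Part :: "nat \<Rightarrow> nat \<Rightarrow> nat set set set" where
  "Part n m = {P. partition_on {1..n} P \<and> card P = m}"

definition Subs :: "nat \<Rightarrow> nat \<Rightarrow> nat set set" where
  "Subs n m = {A. A \<subseteq> {1..n} \<and> card A = m}"

definition transversal :: "nat set \<Rightarrow> nat set set \<Rightarrow> bool" (infix "\<bottom>\<bottom>" 50) where
  "A \<bottom>\<bottom> P \<longleftrightarrow> (\<forall>C\<in>P. \<exists>!x. x \<in> A \<inter> C)"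

abbreviation IGT :: "nat \<Rightarrow> (nat \<Rightarrow> nat) list set monoid" where
  "IGT n \<equiv> IG (full_trans n)"

definition overline :: "nat \<Rightarrow> (nat \<Rightarrow> nat) \<Rightarrow> (nat \<Rightarrow> nat) list set" where
  "overline n e = ig_gen (full_trans n) e"

text \<open>All generators of the same rank lie in one and the same \<open>\<D>\<close>-class, so this set is a
  single \<open>\<D>\<close>-class.\<close>

definition Dbar :: "nat \<Rightarrow> nat \<Rightarrow> (nat \<Rightarrow> nat) list set set" where
  "Dbar n m = {x. \<exists>e \<in> idempotents (full_trans n). rank n e = m \<and>
                    (x, overline n e) \<in> green_D (IGT n)}"


section \<open>Rees matrix coordinates\<close>

text \<open>The data by which the principal factor of \<open>Dbar n m\<close> is identified with a Rees matrix
  semigroup: \<open>base\<close> is the identity of the chosen maximal subgroup, \<open>fent P A\<close> is the entry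
  \<open>f\<^sub>P\<^sub>,\<^sub>A\<close>, and \<open>elt P g A\<close> is the element with coordinates \<open>(P, g, A)\<close>. Such an
  identification is unique only up to the choice of the maximal subgroup and a normalisation
  of the sandwich matrix.\<close>

record rees_data =
  base :: "(nat \<Rightarrow> nat) list set"
  fent :: "nat set set \<Rightarrow> nat set \<Rightarrow> (nat \<Rightarrow> nat) list set"
  elt :: "nat set set \<Rightarrow> (nat \<Rightarrow> nat) list set \<Rightarrow> nat set \<Rightarrow> (nat \<Rightarrow> nat) list set"

definition Gmax :: "nat \<Rightarrow> rees_data \<Rightarrow> (nat \<Rightarrow> nat) list set monoid" where
  "Gmax n \<rho> = max_subgroup (IGT n) (base \<rho>)"

text \<open>In the principal factor a product is nonzero iff, taken in \<open>IGT n\<close>, it stays in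
  \<open>Dbar n m\<close>. The last condition is thus multiplication with the sandwich matrix whose entries
  are the inverses of the \<open>fent Q A\<close> for \<open>A \<bottom>\<bottom> Q\<close> and zero otherwise.\<close>

definition rees_identification :: "nat \<Rightarrow> nat \<Rightarrow> rees_data \<Rightarrow> bool" where
  "rees_identification n m \<rho> \<longleftrightarrow>
     base \<rho> \<in> Dbar n m \<and> base \<rho> \<in> idempotents (IGT n) \<and>
     (\<forall>P\<in>Part n m. \<forall>A\<in>Subs n m. A \<bottom>\<bottom> P \<longrightarrow> fent \<rho> P A \<in> carrier (Gmax n \<rho>)) \<and>
     bij_betw (\<lambda>(P, g, A). elt \<rho> P g A) (Part n m \<times> carrier (Gmax n \<rho>) \<times> Subs n m) (Dbar n m) \<and>
     (\<forall>e\<in>idempotents (full_trans n). rank n e = m \<longrightarrow>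
        overline n e = elt \<rho> (ker n e) (fent \<rho> (ker n e) (im n e)) (im n e)) \<and>
     (\<forall>P\<in>Part n m. \<forall>g\<in>carrier (Gmax n \<rho>). \<forall>A\<in>Subs n m.
      \<forall>Q\<in>Part n m. \<forall>h\<in>carrier (Gmax n \<rho>). \<forall>B\<in>Subs n m.
        if A \<bottom>\<bottom> Q
        then elt \<rho> P g A \<otimes>\<^bsub>IGT n\<^esub> elt \<rho> Q h B =
             elt \<rho> P (g \<otimes>\<^bsub>Gmax n \<rho>\<^esub> inv\<^bsub>Gmax n \<rho>\<^esub> fent \<rho> Q A \<otimes>\<^bsub>Gmax n \<rho>\<^esub> h) B
        else elt \<rho> P g A \<otimes>\<^bsub>IGT n\<^esub> elt \<rho> Q h B \<notin> Dbar n m)"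


section \<open>The contact graph\<close>

definition act_left :: "nat \<Rightarrow> nat \<Rightarrow> rees_data \<Rightarrow> (nat \<Rightarrow> nat) \<Rightarrow> nat set set \<Rightarrow> nat set set \<Rightarrow> bool"
where
  "act_left n m \<rho> e P Q \<longleftrightarrow> P \<in> Part n m \<and> Q \<in> Part n m \<and>
     (\<exists>g\<in>carrier (Gmax n \<rho>). \<exists>h\<in>carrier (Gmax n \<rho>). \<exists>A\<in>Subs n m.
        overline n e \<otimes>\<^bsub>IGT n\<^esub> elt \<rho> P g A = elt \<rho> Q h A)"

definition act_right :: "nat \<Rightarrow> nat \<Rightarrow> rees_data \<Rightarrow> nat set \<Rightarrow> (nat \<Rightarrow> nat) \<Rightarrow> nat set \<Rightarrow> bool"
where
  "act_right n m \<rho> B e A \<longleftrightarrow> B \<in> Subs n m \<and> A \<in> Subs n m \<and>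
     (\<exists>P\<in>Part n m. \<exists>g\<in>carrier (Gmax n \<rho>). \<exists>h\<in>carrier (Gmax n \<rho>).
        elt \<rho> P g B \<otimes>\<^bsub>IGT n\<^esub> overline n e = elt \<rho> P h A)"

type_synonym contact_vertex = "nat set \<times> nat set set"
type_synonym contact_label = "(nat \<Rightarrow> nat) list set \<times> (nat \<Rightarrow> nat) list set"

text \<open>In what follows \<open>\<rho> k\<close> is the Rees identification chosen for \<open>Dbar n k\<close>, so that the same
  one is used on both sides when \<open>m = r\<close>.\<close>

definition label_group ::
  "nat \<Rightarrow> (nat \<Rightarrow> rees_data) \<Rightarrow> nat \<Rightarrow> nat \<Rightarrow> contact_label monoid" where
  "label_group n \<rho> m r = Gmax n (\<rho> m) \<times>\<times> Gmax n (\<rho> r)"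

definition contact_vertices :: "nat \<Rightarrow> nat \<Rightarrow> nat \<Rightarrow> contact_vertex set" where
  "contact_vertices n m r = Subs n m \<times> Part n r"

text \<open>The label of the edge given by \<open>e\<close> does not depend on the auxiliary \<open>P\<^sub>0\<close>, \<open>A\<^sub>0\<close>.\<close>

inductive contact_edge ::
  "nat \<Rightarrow> (nat \<Rightarrow> rees_data) \<Rightarrow> nat \<Rightarrow> nat \<Rightarrow> contact_vertex \<Rightarrow> contact_label \<Rightarrow> contact_vertex \<Rightarrow> bool"
  for n \<rho> m r where
  "\<lbrakk>e \<in> idempotents (full_trans n);
    act_right n m (\<rho> m) B e A; act_left n r (\<rho> r) e P Q;
    act_left n m (\<rho> m) e P\<^sub>0 P\<^sub>0; A \<bottom>\<bottom> P\<^sub>0; B \<bottom>\<bottom> P\<^sub>0;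
    act_right n r (\<rho> r) A\<^sub>0 e A\<^sub>0; A\<^sub>0 \<bottom>\<bottom> P; A\<^sub>0 \<bottom>\<bottom> Q;
    a = inv\<^bsub>Gmax n (\<rho> m)\<^esub> fent (\<rho> m) P\<^sub>0 A \<otimes>\<^bsub>Gmax n (\<rho> m)\<^esub> fent (\<rho> m) P\<^sub>0 B;
    b = fent (\<rho> r) Q A\<^sub>0 \<otimes>\<^bsub>Gmax n (\<rho> r)\<^esub> inv\<^bsub>Gmax n (\<rho> r)\<^esub> fent (\<rho> r) P A\<^sub>0\<rbrakk>
   \<Longrightarrow> contact_edge n \<rho> m r (A, P) (a, inv\<^bsub>Gmax n (\<rho> r)\<^esub> b) (B, Q)"

inductive contact_walk ::
  "nat \<Rightarrow> (nat \<Rightarrow> rees_data) \<Rightarrow> nat \<Rightarrow> nat \<Rightarrow> contact_vertex \<Rightarrow> contact_label \<Rightarrow> contact_vertex \<Rightarrow> bool"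
  for n \<rho> m r where
  empty: "v \<in> contact_vertices n m r \<Longrightarrow>
    contact_walk n \<rho> m r v \<one>\<^bsub>label_group n \<rho> m r\<^esub> v"
| forward: "\<lbrakk>contact_walk n \<rho> m r u g v; contact_edge n \<rho> m r v h w\<rbrakk> \<Longrightarrow>
    contact_walk n \<rho> m r u (g \<otimes>\<^bsub>label_group n \<rho> m r\<^esub> h) w"
| backward: "\<lbrakk>contact_walk n \<rho> m r u g v; contact_edge n \<rho> m r w h v\<rbrakk> \<Longrightarrow>
    contact_walk n \<rho> m r u (g \<otimes>\<^bsub>label_group n \<rho> m r\<^esub> inv\<^bsub>label_group n \<rho> m r\<^esub> h) w"

definition vertex_group ::
  "nat \<Rightarrow> (nat \<Rightarrow> rees_data) \<Rightarrow> nat \<Rightarrow> nat \<Rightarrow> contact_vertex \<Rightarrow> contact_label set" where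
  "vertex_group n \<rho> m r v = {g. contact_walk n \<rho> m r v g v}"

definition saturates :: "nat set \<Rightarrow> nat set set \<Rightarrow> bool" where
  "saturates A P \<longleftrightarrow> (\<forall>C\<in>P. \<exists>x. x \<in> A \<inter> C)"

definition separates :: "nat set set \<Rightarrow> nat set \<Rightarrow> bool" where
  "separates P A \<longleftrightarrow> (\<forall>C\<in>P. \<forall>x\<in>A \<inter> C. \<forall>y\<in>A \<inter> C. x = y)"

definition regular_vertex :: "contact_vertex \<Rightarrow> bool" where
  "regular_vertex = (\<lambda>(A, P). saturates A P \<or> separates P A)"

definition stationary_vertex :: "contact_vertex \<Rightarrow> bool" where
  "stationary_vertex = (\<lambda>(A, P). \<forall>C\<in>P. \<not> C \<subseteq> A \<longrightarrow> is_singleton C)"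

end

theory Submission
  imports Defs
begin

text \<open>The vertex group of a stationary vertex is trivial because only the identity map gives an
  edge at such a vertex. An edge \<open>(A, P) \<rightarrow> (B, Q)\<close> given by \<open>e\<close> means that \<open>e\<close> maps \<open>B\<close> bijectively
  onto \<open>A\<close>, that its image meets every class of \<open>P\<close>, and that the classes of \<open>Q\<close> are the inverse
  images of those of \<open>P\<close>. If \<open>(A, P)\<close> is stationary, the image of \<open>e\<close> contains \<open>A\<close> and all singleton
  classes of \<open>P\<close>, hence everything (\<open>stationary_forward_identity\<close>). If \<open>(B, Q)\<close> is stationary, two
  points with the same value under \<open>e\<close> lie in one class of \<open>Q\<close>, which is a singleton or is contained
  in \<open>B\<close>, where \<open>e\<close> is injective (\<open>stationary_backward_identity\<close>). A surjective or injective
  idempotent is the identity, so the edge is a loop, and both components of its label are trivial,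
  as each comes from an entry \<open>f\<^sub>P\<^sub>,\<^sub>A\<close> and its own inverse.

  The above description of the two actions has to be extracted from the Rees coordinates. Evaluation
  of words is a morphism from \<open>IGT n\<close> to the monoid of maps, and \<open>eval_elt\<close> shows that it sends the
  element with coordinates \<open>(P, g, A)\<close> to a map with kernel \<open>P\<close> and image \<open>A\<close>. An equation
  between elements thus becomes an equation between maps, from which the actions can be read off.

  The equivalence of non-regular and stationary is a counting matter. If \<open>A\<close> omits one point only and
  does not saturate \<open>P\<close>, that point forms a class, and all other classes are contained in \<open>A\<close>. If
  \<open>P\<close> has \<open>n - 1\<close> classes, it has a single class of more than one point, namely of two points; \<open>P\<close>
  does not separate \<open>A\<close> exactly if this class is contained in \<open>A\<close>, and then some singleton class
  is missed by \<open>A\<close>, which has fewer than \<open>n\<close> points.\<close>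


section \<open>Maximal subgroups of a semigroup\<close>

locale carrier_semigroup =
  fixes S (structure)
  assumes closed: "\<And>x y. \<lbrakk>x \<in> carrier S; y \<in> carrier S\<rbrakk> \<Longrightarrow> x \<otimes> y \<in> carrier S"
    and assoc: "\<And>x y z. \<lbrakk>x \<in> carrier S; y \<in> carrier S; z \<in> carrier S\<rbrakk>
      \<Longrightarrow> (x \<otimes> y) \<otimes> z = x \<otimes> (y \<otimes> z)"

lemma (in carrier_semigroup) right_ideal_mult_subset:
  assumes "x \<in> carrier S" "y \<in> carrier S"
  shows "right_ideal S (x \<otimes> y) \<subseteq> right_ideal S x"
  using assms by (auto simp: right_ideal_def assoc intro!: closed)

lemma (in carrier_semigroup) left_ideal_mult_subset:
  assumes "x \<in> carrier S" "y \<in> carrier S"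
  shows "left_ideal S (x \<otimes> y) \<subseteq> left_ideal S y"
  using assms by (auto simp: left_ideal_def simp flip: assoc intro!: closed)

lemma (in carrier_semigroup) green_H_idempotent_iff:
  assumes i: "i \<in> idempotents S"
  shows "x \<in> green_H S `` {i} \<longleftrightarrow> x \<in> carrier S \<and> i \<otimes> x = x \<and> x \<otimes> i = x \<and>
    (\<exists>y\<in>carrier S. x \<otimes> y = i) \<and> (\<exists>z\<in>carrier S. z \<otimes> x = i)" (is "?L \<longleftrightarrow> ?R")
proof -
  have ic: "i \<in> carrier S" and ii: "i \<otimes> i = i"
    using i by (auto simp: idempotents_def)
  have right: "right_ideal S i = right_ideal S x \<longleftrightarrow> i \<otimes> x = x \<and> (\<exists>y\<in>carrier S. x \<otimes> y = i)"
    if x: "x \<in> carrier S"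
  proof
    assume eq: "right_ideal S i = right_ideal S x"
    have "x \<in> right_ideal S i" "i \<in> right_ideal S x"
      using eq by (auto simp: right_ideal_def)
    then have xi: "x = i \<or> (\<exists>s\<in>carrier S. x = i \<otimes> s)"
      and ix: "i = x \<or> (\<exists>s\<in>carrier S. i = x \<otimes> s)"
      unfolding right_ideal_def by blast+
    have "i \<otimes> x = x"
      using xi assoc[OF ic ic] ii by auto
    moreover have "\<exists>y\<in>carrier S. x \<otimes> y = i"
      using ix ii ic by metis
    ultimately show "i \<otimes> x = x \<and> (\<exists>y\<in>carrier S. x \<otimes> y = i)" by blast
  next
    assume "i \<otimes> x = x \<and> (\<exists>y\<in>carrier S. x \<otimes> y = i)"
    then obtain y where y: "i \<otimes> x = x" "y \<in> carrier S" "x \<otimes> y = i" by blast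
    then show "right_ideal S i = right_ideal S x"
      using right_ideal_mult_subset[OF x y(2)] right_ideal_mult_subset[OF ic x] by simp
  qed
  have left: "left_ideal S i = left_ideal S x \<longleftrightarrow> x \<otimes> i = x \<and> (\<exists>z\<in>carrier S. z \<otimes> x = i)"
    if x: "x \<in> carrier S"
  proof
    assume eq: "left_ideal S i = left_ideal S x"
    have "x \<in> left_ideal S i" "i \<in> left_ideal S x"
      using eq by (auto simp: left_ideal_def)
    then have xi: "x = i \<or> (\<exists>s\<in>carrier S. x = s \<otimes> i)"
      and ix: "i = x \<or> (\<exists>s\<in>carrier S. i = s \<otimes> x)"
      unfolding left_ideal_def by blast+
    have "x \<otimes> i = x"
      using xi assoc[OF _ ic ic] ii by auto
    moreover have "\<exists>z\<in>carrier S. z \<otimes> x = i"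
      using ix ii ic by metis
    ultimately show "x \<otimes> i = x \<and> (\<exists>z\<in>carrier S. z \<otimes> x = i)" by blast
  next
    assume "x \<otimes> i = x \<and> (\<exists>z\<in>carrier S. z \<otimes> x = i)"
    then obtain z where z: "x \<otimes> i = x" "z \<in> carrier S" "z \<otimes> x = i" by blast
    then show "left_ideal S i = left_ideal S x"
      using left_ideal_mult_subset[OF z(2) x] left_ideal_mult_subset[OF x ic] by simp
  qed
  show ?thesis
    using left right ic by (auto simp: green_H_def green_L_def green_R_def)
qed

text \<open>Inverses in \<open>Gmax\<close> are given by a definite description, which yields the
  expected elements only once the \<open>\<H>\<close>-class of an idempotent is known to be a group.\<close>

lemma (in carrier_semigroup) group_max_subgroup:
  assumes i: "i \<in> idempotents S"
  shows "group (max_subgroup S i)"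
proof -
  note H = green_H_idempotent_iff[OF i]
  have ic: "i \<in> carrier S" and ii: "i \<otimes> i = i"
    using i by (auto simp: idempotents_def)
  show ?thesis
  proof (rule groupI)
    fix x y assume "x \<in> carrier (max_subgroup S i)" "y \<in> carrier (max_subgroup S i)"
    then have x: "x \<in> green_H S `` {i}" and y: "y \<in> green_H S `` {i}"
      by (simp_all add: max_subgroup_def)
    from x obtain x1 x2 where x': "x \<in> carrier S" "i \<otimes> x = x" "x \<otimes> i = x"
      "x1 \<in> carrier S" "x \<otimes> x1 = i" "x2 \<in> carrier S" "x2 \<otimes> x = i"
      unfolding H by blast
    from y obtain y1 y2 where y': "y \<in> carrier S" "i \<otimes> y = y" "y \<otimes> i = y"
      "y1 \<in> carrier S" "y \<otimes> y1 = i" "y2 \<in> carrier S" "y2 \<otimes> y = i"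
      unfolding H by blast
    have "(x \<otimes> y) \<otimes> (y1 \<otimes> x1) = (x \<otimes> (y \<otimes> y1)) \<otimes> x1"
      using x'(1,4) y'(1,4) by (simp add: assoc closed)
    then have r: "(x \<otimes> y) \<otimes> (y1 \<otimes> x1) = i" using x' y' by simp
    have "(y2 \<otimes> x2) \<otimes> (x \<otimes> y) = y2 \<otimes> ((x2 \<otimes> x) \<otimes> y)"
      using x'(1,6) y'(1,6) by (simp add: assoc closed)
    then have l: "(y2 \<otimes> x2) \<otimes> (x \<otimes> y) = i" using x' y' by simp
    have "i \<otimes> (x \<otimes> y) = x \<otimes> y" using assoc[OF ic x'(1) y'(1)] x' by simp
    moreover have "(x \<otimes> y) \<otimes> i = x \<otimes> y" using assoc[OF x'(1) y'(1) ic] y' by simp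
    ultimately have "x \<otimes> y \<in> green_H S `` {i}"
      unfolding H using r l x' y' closed by blast
    then show "x \<otimes>\<^bsub>max_subgroup S i\<^esub> y \<in> carrier (max_subgroup S i)"
      by (simp add: max_subgroup_def)
  next
    show "\<one>\<^bsub>max_subgroup S i\<^esub> \<in> carrier (max_subgroup S i)"
      using H[of i] ic ii by (auto simp: max_subgroup_def)
  next
    fix x assume "x \<in> carrier (max_subgroup S i)"
    then have x: "x \<in> green_H S `` {i}"
      by (simp add: max_subgroup_def)
    from x obtain y z where x': "x \<in> carrier S" "i \<otimes> x = x" "x \<otimes> i = x"
      "y \<in> carrier S" "x \<otimes> y = i" "z \<in> carrier S" "z \<otimes> x = i"
      unfolding H by blast
    \<comment> \<open>A one-sided inverse need not lie in the subgroup, but its compression by \<open>i\<close> does, and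
      it inverts \<open>x\<close> on both sides because \<open>i \<otimes> y = (z \<otimes> x) \<otimes> y = z \<otimes> i\<close>.\<close>
    define w where "w = i \<otimes> y \<otimes> i"
    have wc: "w \<in> carrier S" using x' ic closed by (simp add: w_def)
    have "i \<otimes> y = z \<otimes> i" using assoc[OF x'(6,1,4)] x' by simp
    then have wz: "w = z \<otimes> i"
      using assoc[OF x'(6) ic ic] ii by (simp add: w_def)
    have wx: "w \<otimes> x = i"
      using assoc[OF x'(6) ic x'(1)] x' by (simp add: wz)
    have wi: "w \<otimes> i = w"
      using assoc[OF x'(6) ic ic] ii by (simp add: wz)
    have wy: "w = i \<otimes> (y \<otimes> i)"
      using assoc[OF ic x'(4) ic] by (simp add: w_def)
    have iw: "i \<otimes> w = w"
      using assoc[OF ic ic closed[OF x'(4) ic]] ii by (simp add: wy)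
    have "x \<otimes> w = (x \<otimes> i) \<otimes> (y \<otimes> i)"
      using assoc[OF x'(1) ic closed[OF x'(4) ic]] by (simp add: wy)
    then have xw: "x \<otimes> w = i"
      using assoc[OF x'(1,4) ic] x' ii by simp
    have "w \<in> green_H S `` {i}"
      unfolding H using wc iw wi xw wx x' by blast
    then show "\<exists>y\<in>carrier (max_subgroup S i). y \<otimes>\<^bsub>max_subgroup S i\<^esub> x = \<one>\<^bsub>max_subgroup S i\<^esub>"
      using wx by (auto simp: max_subgroup_def)
  next
    fix x y z
    assume "x \<in> carrier (max_subgroup S i)" "y \<in> carrier (max_subgroup S i)"
      "z \<in> carrier (max_subgroup S i)"
    then show "x \<otimes>\<^bsub>max_subgroup S i\<^esub> y \<otimes>\<^bsub>max_subgroup S i\<^esub> z =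
        x \<otimes>\<^bsub>max_subgroup S i\<^esub> (y \<otimes>\<^bsub>max_subgroup S i\<^esub> z)"
      using H by (simp add: max_subgroup_def assoc)
  next
    fix x assume "x \<in> carrier (max_subgroup S i)"
    then show "\<one>\<^bsub>max_subgroup S i\<^esub> \<otimes>\<^bsub>max_subgroup S i\<^esub> x = x"
      using H[of x] by (simp add: max_subgroup_def)
  qed
qed


section \<open>Evaluating words over the idempotents\<close>

text \<open>If the product \<open>f \<otimes> e\<close> in the other order is \<open>e\<close> or \<open>f\<close>, it is absorbed in the middle of
  \<open>(e \<otimes> f) \<otimes> (e \<otimes> f)\<close>.\<close>

lemma (in monoid) basic_pair_mult_idempotent:
  assumes "basic_pair G e f"
  shows "e \<otimes> f \<in> idempotents G"
proof -
  have e: "e \<in> carrier G" "e \<otimes> e = e" and f: "f \<in> carrier G" "f \<otimes> f = f"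
    using assms by (auto simp: basic_pair_def idempotents_def)
  have regroup: "(e \<otimes> f) \<otimes> (e \<otimes> f) = e \<otimes> (f \<otimes> e) \<otimes> f"
    using e f by (simp add: m_assoc)
  consider "e \<otimes> f \<in> {e, f}" | "f \<otimes> e = e" | "f \<otimes> e = f"
    using assms by (auto simp: basic_pair_def)
  then have "(e \<otimes> f) \<otimes> (e \<otimes> f) = e \<otimes> f"
  proof cases
    case 1
    then show ?thesis using e f by auto
  next
    case 2
    then show ?thesis using e by (simp add: regroup)
  next
    case 3
    then show ?thesis using e f by (simp add: regroup m_assoc)
  qed
  then show ?thesis
    using e f by (simp add: idempotents_def)
qed

lemma (in monoid) ig_eq_words:
  assumes "ig_eq G u v"
  shows "u \<in> ig_words G \<and> v \<in> ig_words G"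
  using assms
proof induction
  case (relation e f u v)
  then show ?case
    using basic_pair_mult_idempotent[of e f] by (auto simp: ig_words_def basic_pair_def)
qed auto

lemma ig_words_append: "\<lbrakk>u \<in> ig_words S; v \<in> ig_words S\<rbrakk> \<Longrightarrow> u @ v \<in> ig_words S"
  by (auto simp: ig_words_def)

lemma ig_eq_append_right:
  assumes "ig_eq S u v" "w \<in> ig_words S"
  shows "ig_eq S (u @ w) (v @ w)"
  using assms
proof induction
  case (relation e f u v)
  then show ?case
    using ig_eq.relation[of S e f u "v @ w"] by (auto simp: ig_words_def)
next
  case (refl u)
  then show ?case by (simp add: ig_eq.refl ig_words_append)
next
  case (sym u v)
  then show ?case by (blast intro: ig_eq.sym)
next
  case (trans u v w)
  then show ?case by (blast intro: ig_eq.trans)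
qed

lemma ig_eq_append_left:
  assumes "ig_eq S u v" "w \<in> ig_words S"
  shows "ig_eq S (w @ u) (w @ v)"
  using assms
proof induction
  case (relation e f u v)
  then show ?case
    using ig_eq.relation[of S e f "w @ u" v] by (auto simp: ig_words_def)
next
  case (refl u)
  then show ?case by (simp add: ig_eq.refl ig_words_append)
next
  case (sym u v)
  then show ?case by (blast intro: ig_eq.sym)
next
  case (trans u v w)
  then show ?case by (blast intro: ig_eq.trans)
qed

lemma ig_class_eqI:
  assumes "ig_eq S u v"
  shows "ig_class S u = ig_class S v"
proof -
  have "ig_eq S u w \<longleftrightarrow> ig_eq S v w" for w
    using assms ig_eq.sym ig_eq.trans by metis
  then show ?thesis by (simp add: ig_class_def)
qed

lemma (in monoid) IG_mult_class:
  assumes u: "u \<in> ig_words G" and v: "v \<in> ig_words G"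
  shows "ig_class G u \<otimes>\<^bsub>IG G\<^esub> ig_class G v = ig_class G (u @ v)"
proof -
  have "ig_class G (u' @ v') = ig_class G (u @ v)"
    if "u' \<in> ig_class G u" "v' \<in> ig_class G v" for u' v'
  proof -
    have uu: "ig_eq G u u'" and vv: "ig_eq G v v'"
      using that by (simp_all add: ig_class_def)
    then have "ig_eq G (u @ v) (u' @ v')"
      using ig_eq_append_right[OF uu v] ig_eq_append_left[OF vv] ig_eq_words[OF uu]
      by (blast intro: ig_eq.trans)
    then show ?thesis
      by (simp add: ig_class_eqI)
  qed
  moreover have "u \<in> ig_class G u" "v \<in> ig_class G v"
    using u v by (auto simp: ig_class_def intro: ig_eq.refl)
  ultimately have "(\<Union>u'\<in>ig_class G u. \<Union>v'\<in>ig_class G v. ig_class G (u' @ v')) =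
      ig_class G (u @ v)"
    by blast
  then show ?thesis
    by (simp add: IG_def)
qed

lemma (in monoid) carrier_semigroup_IG: "carrier_semigroup (IG G)"
proof
  fix X Y assume "X \<in> carrier (IG G)" "Y \<in> carrier (IG G)"
  then obtain u v where "u \<in> ig_words G" "v \<in> ig_words G" "X = ig_class G u" "Y = ig_class G v"
    by (auto simp: IG_def)
  then show "X \<otimes>\<^bsub>IG G\<^esub> Y \<in> carrier (IG G)"
    using IG_mult_class[of u v] ig_words_append[of u G v] by (simp add: IG_def)
next
  fix X Y Z assume "X \<in> carrier (IG G)" "Y \<in> carrier (IG G)" "Z \<in> carrier (IG G)"
  then obtain u v w where "u \<in> ig_words G" "v \<in> ig_words G" "w \<in> ig_words G"
    "X = ig_class G u" "Y = ig_class G v" "Z = ig_class G w"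
    by (auto simp: IG_def)
  then show "(X \<otimes>\<^bsub>IG G\<^esub> Y) \<otimes>\<^bsub>IG G\<^esub> Z = X \<otimes>\<^bsub>IG G\<^esub> (Y \<otimes>\<^bsub>IG G\<^esub> Z)"
    by (simp add: IG_mult_class ig_words_append)
qed

definition eval_word :: "('a, 'b) monoid_scheme \<Rightarrow> 'a list \<Rightarrow> 'a" where
  "eval_word S w = foldr (mult S) w \<one>\<^bsub>S\<^esub>"

lemma (in monoid) eval_word_closed: "set w \<subseteq> carrier G \<Longrightarrow> eval_word G w \<in> carrier G"
  by (induction w) (auto simp: eval_word_def)

lemma (in monoid) eval_word_append:
  "\<lbrakk>set u \<subseteq> carrier G; set v \<subseteq> carrier G\<rbrakk>
    \<Longrightarrow> eval_word G (u @ v) = eval_word G u \<otimes> eval_word G v"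
proof (induction u)
  case Nil
  then show ?case using eval_word_closed[of v] by (simp add: eval_word_def)
next
  case (Cons a u)
  then show ?case
    using eval_word_closed[of u] eval_word_closed[of v] by (simp add: eval_word_def m_assoc)
qed

lemma idempotents_subset_carrier: "idempotents S \<subseteq> carrier S"
  by (auto simp: idempotents_def)

lemma (in monoid) ig_eq_eval_word:
  assumes "ig_eq G u v"
  shows "eval_word G u = eval_word G v"
  using assms
proof induction
  case (relation e f u v)
  have "set u \<subseteq> carrier G" "set v \<subseteq> carrier G" "e \<in> carrier G" "f \<in> carrier G"
    using relation idempotents_subset_carrier[of G] by (auto simp: basic_pair_def)
  then show ?case
    using eval_word_closed[of v]
    by (simp only: eval_word_append) (simp add: eval_word_append eval_word_def m_assoc)
qed auto

definition ig_eval :: "('a, 'b) monoid_scheme \<Rightarrow> 'a list set \<Rightarrow> 'a" where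
  "ig_eval S X = eval_word S (SOME w. w \<in> X)"

lemma (in monoid) ig_eval_class:
  assumes "w \<in> ig_words G"
  shows "ig_eval G (ig_class G w) = eval_word G w"
proof -
  have "(SOME v. v \<in> ig_class G w) \<in> ig_class G w"
    by (rule someI[of _ w]) (use assms in \<open>auto simp: ig_class_def intro: ig_eq.refl\<close>)
  then show ?thesis
    using ig_eq_eval_word by (force simp: ig_eval_def ig_class_def)
qed

text \<open>Every defining relation of \<open>IG G\<close> holds in \<open>G\<close>, so the value of a word depends only on its
  class. This is how the elements of \<open>IG G\<close> are compared with those of \<open>G\<close>.\<close>

lemma (in monoid) ig_eval_hom: "ig_eval G \<in> hom (IG G) G"
proof (rule homI)
  fix X assume "X \<in> carrier (IG G)"
  then obtain u where u: "u \<in> ig_words G" "X = ig_class G u"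
    by (auto simp: IG_def)
  then show "ig_eval G X \<in> carrier G"
    using idempotents_subset_carrier[of G] eval_word_closed[of u]
    by (auto simp: ig_eval_class ig_words_def)
next
  fix X Y assume "X \<in> carrier (IG G)" "Y \<in> carrier (IG G)"
  then obtain u v where u: "u \<in> ig_words G" "X = ig_class G u"
    and v: "v \<in> ig_words G" "Y = ig_class G v"
    by (auto simp: IG_def)
  have "set u \<subseteq> carrier G" "set v \<subseteq> carrier G"
    using u v idempotents_subset_carrier[of G] by (auto simp: ig_words_def)
  then show "ig_eval G (X \<otimes>\<^bsub>IG G\<^esub> Y) = ig_eval G X \<otimes> ig_eval G Y"
    using u v by (simp add: IG_mult_class ig_eval_class ig_words_append eval_word_append)
qed

lemma (in monoid) ig_gen_carrier: "e \<in> idempotents G \<Longrightarrow> ig_gen G e \<in> carrier (IG G)"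
  by (auto simp: ig_gen_def IG_def ig_words_def)

lemma (in monoid) ig_eval_gen: "e \<in> idempotents G \<Longrightarrow> ig_eval G (ig_gen G e) = e"
  using idempotents_subset_carrier[of G]
  by (auto simp: ig_gen_def ig_eval_class ig_words_def eval_word_def)


section \<open>Kernels and images of transformations\<close>

lemma carrier_full_trans: "carrier (full_trans n) = {1..n} \<rightarrow>\<^sub>E {1..n}"
  by (simp add: full_trans_def)

lemma full_trans_mult_apply:
  "x \<in> {1..n} \<Longrightarrow> (e \<otimes>\<^bsub>full_trans n\<^esub> f) x = f (e x)"
  by (simp add: full_trans_def compose_def)

lemma full_trans_apply: "\<lbrakk>e \<in> carrier (full_trans n); x \<in> {1..n}\<rbrakk> \<Longrightarrow> e x \<in> {1..n}"
  unfolding carrier_full_trans by (rule PiE_mem)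

lemma full_trans_eqI:
  "\<lbrakk>e \<in> carrier (full_trans n); f \<in> carrier (full_trans n); \<And>x. x \<in> {1..n} \<Longrightarrow> e x = f x\<rbrakk>
    \<Longrightarrow> e = f"
  unfolding carrier_full_trans by (rule PiE_ext)

lemma full_trans_mult_closed:
  assumes "e \<in> carrier (full_trans n)" "f \<in> carrier (full_trans n)"
  shows "e \<otimes>\<^bsub>full_trans n\<^esub> f \<in> carrier (full_trans n)"
proof -
  have "f (e x) \<in> {1..n}" if "x \<in> {1..n}" for x
    using assms that full_trans_apply by blast
  then show ?thesis
    by (simp add: full_trans_def compose_def restrict_PiE_iff del: atLeastAtMost_iff)
qed

lemma monoid_full_trans: "monoid (full_trans n)"
proof (rule monoidI)
  have one: "\<one>\<^bsub>full_trans n\<^esub> x = x" if "x \<in> {1..n}" for x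
    using that by (simp add: full_trans_def)
  show one_closed: "\<one>\<^bsub>full_trans n\<^esub> \<in> carrier (full_trans n)"
    by (simp add: full_trans_def)
  fix x assume x: "x \<in> carrier (full_trans n)"
  note xa = full_trans_apply[OF x]
  show "\<one>\<^bsub>full_trans n\<^esub> \<otimes>\<^bsub>full_trans n\<^esub> x = x"
    by (rule full_trans_eqI[OF full_trans_mult_closed[OF one_closed x] x])
      (simp only: full_trans_mult_apply one)
  show "x \<otimes>\<^bsub>full_trans n\<^esub> \<one>\<^bsub>full_trans n\<^esub> = x"
    by (rule full_trans_eqI[OF full_trans_mult_closed[OF x one_closed] x])
      (simp only: full_trans_mult_apply one xa)
  fix y assume y: "y \<in> carrier (full_trans n)"
  show "x \<otimes>\<^bsub>full_trans n\<^esub> y \<in> carrier (full_trans n)"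
    by (rule full_trans_mult_closed[OF x y])
  fix z assume z: "z \<in> carrier (full_trans n)"
  show "x \<otimes>\<^bsub>full_trans n\<^esub> y \<otimes>\<^bsub>full_trans n\<^esub> z =
      x \<otimes>\<^bsub>full_trans n\<^esub> (y \<otimes>\<^bsub>full_trans n\<^esub> z)"
    by (rule full_trans_eqI[OF full_trans_mult_closed[OF full_trans_mult_closed[OF x y] z]
          full_trans_mult_closed[OF x full_trans_mult_closed[OF y z]]])
      (simp only: full_trans_mult_apply xa)
qed

lemma idempotent_full_trans_iff:
  "e \<in> idempotents (full_trans n) \<longleftrightarrow>
     e \<in> carrier (full_trans n) \<and> (\<forall>x\<in>{1..n}. e (e x) = e x)" (is "?L \<longleftrightarrow> ?R")
proof
  assume ?L
  then have "e \<in> carrier (full_trans n)" and ee: "e \<otimes>\<^bsub>full_trans n\<^esub> e = e"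
    by (simp_all add: idempotents_def)
  moreover have "e (e x) = e x" if "x \<in> {1..n}" for x
    using full_trans_mult_apply[OF that, of e e] ee by simp
  ultimately show ?R by blast
next
  assume R: ?R
  then have "e \<otimes>\<^bsub>full_trans n\<^esub> e = e"
    using full_trans_eqI[OF full_trans_mult_closed, of e n e e] full_trans_mult_apply by metis
  then show ?L using R by (simp add: idempotents_def)
qed

lemma ker_eqI:
  assumes "\<And>x y. \<lbrakk>x \<in> {1..n}; y \<in> {1..n}\<rbrakk> \<Longrightarrow> s x = s y \<longleftrightarrow> t x = t y"
  shows "ker n s = ker n t"
proof -
  have "ker n s = (\<lambda>z. {x \<in> {1..n}. s x = s z}) ` {1..n}" for s
    by (auto simp: ker_def im_def)
  then show ?thesis
    using assms by (auto intro!: image_cong)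
qed

lemma im_in_Subs: "s \<in> carrier (full_trans n) \<Longrightarrow> im n s \<in> Subs n (rank n s)"
  by (auto simp: Subs_def rank_def im_def dest: full_trans_apply)

lemma ker_in_Part: "ker n s \<in> Part n (rank n s)"
proof -
  have eq: "ker n s = (\<lambda>y. {x \<in> {1..n}. s x = y}) ` im n s"
    by (auto simp: ker_def)
  have "inj_on (\<lambda>y. {x \<in> {1..n}. s x = y}) (im n s)"
  proof (rule inj_onI)
    fix y y' assume "y \<in> im n s" and fib: "{x \<in> {1..n}. s x = y} = {x \<in> {1..n}. s x = y'}"
    then obtain x where "x \<in> {x \<in> {1..n}. s x = y}" by (auto simp: im_def)
    moreover from this have "x \<in> {x \<in> {1..n}. s x = y'}" using fib by blast
    ultimately show "y = y'" by simp
  qed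
  then have "card (ker n s) = rank n s"
    by (simp add: eq card_image rank_def)
  moreover have "partition_on {1..n} (ker n s)"
  proof (rule partition_onI)
    show "\<Union>(ker n s) = {1..n}"
      unfolding ker_def im_def by blast
    show "{} \<notin> ker n s"
      unfolding ker_def im_def by blast
    show "disjnt p q" if "p \<in> ker n s" "q \<in> ker n s" "p \<noteq> q" for p q
      using that by (auto simp: ker_def disjnt_def)
  qed
  ultimately show ?thesis
    by (simp add: Part_def)
qed

lemma idempotent_im_transversal_ker:
  assumes "e \<in> idempotents (full_trans n)"
  shows "im n e \<bottom>\<bottom> ker n e"
  unfolding transversal_def
proof
  fix C assume "C \<in> ker n e"
  then obtain z where z: "z \<in> {1..n}" "C = {x \<in> {1..n}. e x = e z}"
    by (auto simp: ker_def im_def)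
  have e: "e x \<in> {1..n}" "e (e x) = e x" if "x \<in> {1..n}" for x
    using assms that full_trans_apply[of e n x] by (auto simp: idempotent_full_trans_iff)
  show "\<exists>!x. x \<in> im n e \<inter> C"
  proof (rule ex1I)
    show "e z \<in> im n e \<inter> C" using z e by (auto simp: im_def)
  next
    fix x assume "x \<in> im n e \<inter> C"
    then show "x = e z" using z e by (auto simp: im_def)
  qed
qed

lemma idempotent_with_kernel:
  assumes "P \<in> Part n m"
  obtains e where "e \<in> idempotents (full_trans n)" "ker n e = P" "rank n e = m"
proof -
  have P: "partition_on {1..n} P" "card P = m"
    using assms by (auto simp: Part_def)
  define e where "e = (\<lambda>x\<in>{1..n}. SOME y. \<exists>C\<in>P. x \<in> C \<and> y \<in> C)"
  have same: "C = D" if "C \<in> P" "D \<in> P" "x \<in> C" "x \<in> D" for C D x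
    using P(1) that by (auto simp: partition_on_def disjoint_def)
  have ex: "\<exists>C\<in>P. x \<in> C \<and> e x \<in> C" if x: "x \<in> {1..n}" for x
  proof -
    have "x \<in> \<Union>P" using x P(1) by (simp add: partition_on_def)
    then obtain C where "C \<in> P" "x \<in> C" by blast
    then have "\<exists>y. \<exists>C\<in>P. x \<in> C \<and> y \<in> C" by blast
    from someI_ex[OF this] show ?thesis using x by (simp add: e_def)
  qed
  have sub: "C \<subseteq> {1..n}" if "C \<in> P" for C
    using that P(1) by (auto simp: partition_on_def)
  have eqv: "e x = e y \<longleftrightarrow> y \<in> C" if "C \<in> P" "x \<in> C" "y \<in> {1..n}" for x y C
  proof
    have xn: "x \<in> {1..n}" using sub that by blast
    assume "e x = e y"
    moreover obtain D where "D \<in> P" "x \<in> D" "e x \<in> D" using ex[OF xn] by blast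
    moreover obtain F where "F \<in> P" "y \<in> F" "e y \<in> F" using ex[OF \<open>y \<in> {1..n}\<close>] by blast
    ultimately show "y \<in> C" using same that by metis
  next
    assume y: "y \<in> C"
    have xn: "x \<in> {1..n}" using sub that by blast
    have "D = C" if "D \<in> P" "x \<in> D \<or> y \<in> D" for D
      using same \<open>C \<in> P\<close> \<open>x \<in> C\<close> y that by blast
    then have "(\<exists>D\<in>P. x \<in> D \<and> z \<in> D) \<longleftrightarrow> (\<exists>D\<in>P. y \<in> D \<and> z \<in> D)" for z
      using \<open>C \<in> P\<close> \<open>x \<in> C\<close> y by blast
    then show "e x = e y" using xn that by (simp add: e_def)
  qed
  have cl: "e x \<in> {1..n}" if "x \<in> {1..n}" for x
    using ex[OF that] sub by blast
  have "e (e x) = e x" if x: "x \<in> {1..n}" for x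
  proof -
    obtain C where "C \<in> P" "x \<in> C" "e x \<in> C" using ex[OF x] by blast
    then show ?thesis using eqv cl[OF x] by metis
  qed
  moreover have "e \<in> carrier (full_trans n)"
    unfolding carrier_full_trans using cl
    by (simp add: PiE_def e_def del: atLeastAtMost_iff)
  ultimately have idem: "e \<in> idempotents (full_trans n)"
    by (simp add: idempotent_full_trans_iff)
  have cls: "{y \<in> {1..n}. e y = e x} = C" if C: "C \<in> P" "x \<in> C" for x C
  proof (intro subset_antisym subsetI)
    fix y assume "y \<in> {y \<in> {1..n}. e y = e x}"
    then have "y \<in> {1..n}" "e x = e y" by simp_all
    then show "y \<in> C" using eqv[OF C] by blast
  next
    fix y assume y: "y \<in> C"
    then have yn: "y \<in> {1..n}" using sub C by blast
    then have "e x = e y" using eqv[OF C yn] y by blast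
    then show "y \<in> {y \<in> {1..n}. e y = e x}" using yn by simp
  qed
  have "ker n e = P"
  proof
    show "ker n e \<subseteq> P"
    proof
      fix C assume "C \<in> ker n e"
      then obtain x where x: "x \<in> {1..n}" "C = {y \<in> {1..n}. e y = e x}"
        by (auto simp: ker_def im_def)
      obtain D where "D \<in> P" "x \<in> D" using ex[OF x(1)] by blast
      then show "C \<in> P" using cls x by simp
    qed
    show "P \<subseteq> ker n e"
    proof
      fix C assume C: "C \<in> P"
      then have "C \<noteq> {}" using P(1) by (auto simp: partition_on_def)
      then obtain x where "x \<in> C" by blast
      then show "C \<in> ker n e"
        using cls[OF C, of x] sub[OF C] unfolding ker_def im_def by blast
    qed
  qed
  moreover from this have "rank n e = m"
    using ker_in_Part[of n e] P(2) by (simp add: Part_def)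
  ultimately show ?thesis using that idem by blast
qed

lemma idempotent_with_image:
  assumes "A \<in> Subs n m" "0 < m"
  obtains f where "f \<in> idempotents (full_trans n)" "im n f = A" "rank n f = m"
proof -
  have A: "A \<subseteq> {1..n}" "card A = m" using assms by (auto simp: Subs_def)
  then obtain a where a: "a \<in> A" using assms(2) by fastforce
  define f where "f = (\<lambda>x\<in>{1..n}. if x \<in> A then x else a)"
  have "f \<in> idempotents (full_trans n)"
    unfolding idempotent_full_trans_iff carrier_full_trans using A a by (auto simp: f_def)
  moreover have "im n f = A"
  proof
    show "im n f \<subseteq> A" using a by (auto simp: im_def f_def)
    show "A \<subseteq> im n f"
    proof
      fix x assume "x \<in> A"
      then have "x = f x" "x \<in> {1..n}" using A by (auto simp: f_def)
      then show "x \<in> im n f" unfolding im_def by blast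
    qed
  qed
  ultimately show ?thesis using that A by (simp add: rank_def)
qed

lemma idempotent_full_trans_identity:
  assumes e: "e \<in> idempotents (full_trans n)"
    and "inj_on e {1..n} \<or> {1..n} \<subseteq> e ` {1..n}" and x: "x \<in> {1..n}"
  shows "e x = x"
proof -
  have idem: "e y \<in> {1..n}" "e (e y) = e y" if "y \<in> {1..n}" for y
    using e that full_trans_apply[of e n y] by (auto simp: idempotent_full_trans_iff)
  from assms(2) show ?thesis
  proof
    assume "inj_on e {1..n}"
    then show ?thesis using idem[OF x] x by (simp add: inj_on_def del: atLeastAtMost_iff)
  next
    assume "{1..n} \<subseteq> e ` {1..n}"
    then obtain y where "y \<in> {1..n}" "x = e y" using x by blast
    then show ?thesis using idem by simp
  qed
qed


section \<open>Rees coordinates are kernels and images\<close>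

lemma overline_carrier: "e \<in> idempotents (full_trans n) \<Longrightarrow> overline n e \<in> carrier (IGT n)"
  unfolding overline_def by (rule monoid.ig_gen_carrier[OF monoid_full_trans])

lemma eval_overline:
  "e \<in> idempotents (full_trans n) \<Longrightarrow> ig_eval (full_trans n) (overline n e) = e"
  unfolding overline_def by (rule monoid.ig_eval_gen[OF monoid_full_trans])

lemma eval_mult:
  "\<lbrakk>X \<in> carrier (IGT n); Y \<in> carrier (IGT n)\<rbrakk> \<Longrightarrow>
    ig_eval (full_trans n) (X \<otimes>\<^bsub>IGT n\<^esub> Y) =
    ig_eval (full_trans n) X \<otimes>\<^bsub>full_trans n\<^esub> ig_eval (full_trans n) Y"
  by (rule hom_mult[OF monoid.ig_eval_hom[OF monoid_full_trans]])

lemma eval_closed: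
  "X \<in> carrier (IGT n) \<Longrightarrow> ig_eval (full_trans n) X \<in> carrier (full_trans n)"
  by (rule hom_in_carrier[OF monoid.ig_eval_hom[OF monoid_full_trans]])

lemma group_Gmax: "rees_identification n m \<rho> \<Longrightarrow> group (Gmax n \<rho>)"
  unfolding Gmax_def rees_identification_def
  by (simp add: carrier_semigroup.group_max_subgroup
      monoid.carrier_semigroup_IG[OF monoid_full_trans])

lemma fent_closed:
  "\<lbrakk>rees_identification n m \<rho>; P \<in> Part n m; A \<in> Subs n m; A \<bottom>\<bottom> P\<rbrakk>
    \<Longrightarrow> fent \<rho> P A \<in> carrier (Gmax n \<rho>)"
  unfolding rees_identification_def by blast

lemma overline_coordinates:
  "\<lbrakk>rees_identification n m \<rho>; e \<in> idempotents (full_trans n); rank n e = m\<rbrakk>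
    \<Longrightarrow> overline n e = elt \<rho> (ker n e) (fent \<rho> (ker n e) (im n e)) (im n e)"
  unfolding rees_identification_def by blast

lemma elt_carrier:
  assumes "rees_identification n m \<rho>"
    and "P \<in> Part n m" "g \<in> carrier (Gmax n \<rho>)" "A \<in> Subs n m"
  shows "elt \<rho> P g A \<in> carrier (IGT n)"
proof -
  have "bij_betw (\<lambda>(P, g, A). elt \<rho> P g A)
      (Part n m \<times> carrier (Gmax n \<rho>) \<times> Subs n m) (Dbar n m)"
    using assms(1) by (simp add: rees_identification_def)
  from bij_betw_apply[OF this, of "(P, g, A)"] have "elt \<rho> P g A \<in> Dbar n m"
    using assms by simp
  then show ?thesis
    by (auto simp: Dbar_def green_D_def green_L_def)
qed

lemma elt_mult:
  assumes "rees_identification n m \<rho>"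
    and "P \<in> Part n m" "g \<in> carrier (Gmax n \<rho>)" "A \<in> Subs n m"
    and "Q \<in> Part n m" "h \<in> carrier (Gmax n \<rho>)" "B \<in> Subs n m"
    and "A \<bottom>\<bottom> Q"
  shows "elt \<rho> P g A \<otimes>\<^bsub>IGT n\<^esub> elt \<rho> Q h B =
     elt \<rho> P (g \<otimes>\<^bsub>Gmax n \<rho>\<^esub> inv\<^bsub>Gmax n \<rho>\<^esub> fent \<rho> Q A \<otimes>\<^bsub>Gmax n \<rho>\<^esub> h) B"
proof -
  have "if A \<bottom>\<bottom> Q
        then elt \<rho> P g A \<otimes>\<^bsub>IGT n\<^esub> elt \<rho> Q h B =
             elt \<rho> P (g \<otimes>\<^bsub>Gmax n \<rho>\<^esub> inv\<^bsub>Gmax n \<rho>\<^esub> fent \<rho> Q A \<otimes>\<^bsub>Gmax n \<rho>\<^esub> h) B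
        else elt \<rho> P g A \<otimes>\<^bsub>IGT n\<^esub> elt \<rho> Q h B \<notin> Dbar n m"
    using assms unfolding rees_identification_def by blast
  then show ?thesis using assms(8) by simp
qed

text \<open>The group coordinate does not influence the kernel and the image of the associated map \<open>s\<close>.
  Multiplying \<open>(P, g, A)\<close> from the left by a generator with kernel \<open>P\<close>, or from the right by one
  with image \<open>A\<close>, changes nothing, so \<open>s\<close> identifies at least the points in a common class of \<open>P\<close> and
  maps into \<open>A\<close>. As \<open>(P, g, A)\<close> can also be multiplied from the right to give a generator with
  kernel \<open>P\<close>, the map \<open>s\<close> identifies no further points; then it has \<open>m\<close> values, and these exhaust \<open>A\<close>.\<close>

lemma eval_elt:
  assumes R: "rees_identification n m \<rho>" and m: "0 < m"
    and P: "P \<in> Part n m" and g: "g \<in> carrier (Gmax n \<rho>)" and A: "A \<in> Subs n m"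
  defines "s \<equiv> ig_eval (full_trans n) (elt \<rho> P g A)"
  shows "s \<in> carrier (full_trans n)" and "ker n s = P" and "im n s = A"
proof -
  interpret G: group "Gmax n \<rho>" by (rule group_Gmax[OF R])
  let ?T = "full_trans n"
  obtain e where e: "e \<in> idempotents ?T" "ker n e = P" "rank n e = m"
    by (rule idempotent_with_kernel[OF P])
  obtain f where f: "f \<in> idempotents ?T" "im n f = A" "rank n f = m"
    by (rule idempotent_with_image[OF A m])
  define B where "B = im n e"
  define Q where "Q = ker n f"
  have ec: "e \<in> carrier ?T" using e(1) by (simp add: idempotents_def)
  have B: "B \<in> Subs n m" "B \<bottom>\<bottom> P"
    using im_in_Subs[OF ec] idempotent_im_transversal_ker[OF e(1)] e by (simp_all add: B_def)
  have Q: "Q \<in> Part n m" "A \<bottom>\<bottom> Q"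
    using ker_in_Part[of n f] idempotent_im_transversal_ker[OF f(1)] f by (simp_all add: Q_def)
  define p where "p = fent \<rho> P B"
  define q where "q = fent \<rho> Q A"
  have p: "p \<in> carrier (Gmax n \<rho>)" and q: "q \<in> carrier (Gmax n \<rho>)"
    using fent_closed[OF R P] fent_closed[OF R _ A] B Q by (simp_all add: p_def q_def)
  have ebar: "overline n e = elt \<rho> P p B"
    using overline_coordinates[OF R e(1,3)] e(2) by (simp add: p_def B_def)
  have fbar: "overline n f = elt \<rho> Q q A"
    using overline_coordinates[OF R f(1,3)] f(2) by (simp add: q_def Q_def)
  note sc = elt_carrier[OF R P g A]
  show "s \<in> carrier ?T"
    unfolding s_def by (rule eval_closed[OF sc])

  have "overline n e \<otimes>\<^bsub>IGT n\<^esub> elt \<rho> P g A = elt \<rho> P g A"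
    unfolding ebar using elt_mult[OF R P p B(1) P g A B(2)] p g by (simp flip: p_def)
  then have es: "e \<otimes>\<^bsub>?T\<^esub> s = s"
    using eval_mult[OF overline_carrier[OF e(1)] sc] eval_overline[OF e(1)] by (simp add: s_def)
  have "elt \<rho> P g A \<otimes>\<^bsub>IGT n\<^esub> overline n f = elt \<rho> P g A"
    unfolding fbar using elt_mult[OF R P g A Q(1) q A Q(2)] q g
    by (simp add: G.m_assoc flip: q_def)
  then have sf: "s \<otimes>\<^bsub>?T\<^esub> f = s"
    using eval_mult[OF sc overline_carrier[OF f(1)]] eval_overline[OF f(1)] by (simp add: s_def)

  \<comment> \<open>The group coordinate \<open>h\<close> is the solution of \<open>g \<otimes> inv q \<otimes> h = p\<close>.\<close>
  define h where "h = q \<otimes>\<^bsub>Gmax n \<rho>\<^esub> inv\<^bsub>Gmax n \<rho>\<^esub> g \<otimes>\<^bsub>Gmax n \<rho>\<^esub> p"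
  define t where "t = ig_eval ?T (elt \<rho> Q h B)"
  have h: "h \<in> carrier (Gmax n \<rho>)"
    using p q g by (simp add: h_def)
  have "g \<otimes>\<^bsub>Gmax n \<rho>\<^esub> inv\<^bsub>Gmax n \<rho>\<^esub> q \<otimes>\<^bsub>Gmax n \<rho>\<^esub> h = p"
  proof -
    have "x \<otimes>\<^bsub>Gmax n \<rho>\<^esub> (inv\<^bsub>Gmax n \<rho>\<^esub> x \<otimes>\<^bsub>Gmax n \<rho>\<^esub> y) = y"
      "inv\<^bsub>Gmax n \<rho>\<^esub> x \<otimes>\<^bsub>Gmax n \<rho>\<^esub> (x \<otimes>\<^bsub>Gmax n \<rho>\<^esub> y) = y"
      if "x \<in> carrier (Gmax n \<rho>)" "y \<in> carrier (Gmax n \<rho>)" for x y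
      using that by (simp_all flip: G.m_assoc)
    then show ?thesis
      using p q g by (simp add: h_def G.m_assoc)
  qed
  then have "elt \<rho> P g A \<otimes>\<^bsub>IGT n\<^esub> elt \<rho> Q h B = overline n e"
    using elt_mult[OF R P g A Q(1) h B(1) Q(2)] by (simp add: ebar flip: q_def)
  then have st: "s \<otimes>\<^bsub>?T\<^esub> t = e"
    using eval_mult[OF sc elt_carrier[OF R Q(1) h B(1)]] eval_overline[OF e(1)]
    by (simp add: s_def t_def)

  have "ker n s = ker n e"
  proof (rule ker_eqI)
    fix x y assume xy: "x \<in> {1..n}" "y \<in> {1..n}"
    have "s z = s (e z)" "e z = t (s z)" if "z \<in> {1..n}" for z
      using full_trans_mult_apply[OF that, of e s] full_trans_mult_apply[OF that, of s t] es st
      by simp_all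
    then show "s x = s y \<longleftrightarrow> e x = e y" using xy by metis
  qed
  then show ker: "ker n s = P" using e by simp
  have "im n s \<subseteq> im n f"
  proof -
    have "s z = f (s z)" if "z \<in> {1..n}" for z
      using full_trans_mult_apply[OF that, of s f] sf by simp
    then show ?thesis
      using full_trans_apply[OF \<open>s \<in> carrier ?T\<close>] by (force simp: im_def)
  qed
  moreover have "card (im n s) = m"
    using ker_in_Part[of n s] ker P by (simp add: Part_def rank_def)
  moreover have "finite A" "card A = m"
    using A finite_subset[of A "{1..n}"] by (auto simp: Subs_def)
  ultimately show "im n s = A"
    using f(2) by (simp add: card_subset_eq)
qed


section \<open>The actions of generators\<close>

text \<open>The defining equation of the action evaluates to a factorisation of a map with image \<open>A\<close>
  into a map with image \<open>B\<close> followed by \<open>e\<close>. Injectivity follows as \<open>A\<close> and \<open>B\<close> have equal size.\<close>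

lemma act_rightD:
  assumes R: "rees_identification n m \<rho>" and m: "0 < m"
    and e: "e \<in> idempotents (full_trans n)" and act: "act_right n m \<rho> B e A"
  shows "e ` B = A" and "inj_on e B"
proof -
  obtain P g h where B: "B \<in> Subs n m" and A: "A \<in> Subs n m" and P: "P \<in> Part n m"
    and g: "g \<in> carrier (Gmax n \<rho>)" and h: "h \<in> carrier (Gmax n \<rho>)"
    and eq: "elt \<rho> P g B \<otimes>\<^bsub>IGT n\<^esub> overline n e = elt \<rho> P h A"
    using act by (auto simp: act_right_def)
  define s where "s = ig_eval (full_trans n) (elt \<rho> P g B)"
  define t where "t = ig_eval (full_trans n) (elt \<rho> P h A)"
  have "t = s \<otimes>\<^bsub>full_trans n\<^esub> e"
    using eval_mult[OF elt_carrier[OF R P g B] overline_carrier[OF e]] eq eval_overline[OF e]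
    by (simp add: s_def t_def)
  then have "t x = e (s x)" if "x \<in> {1..n}" for x
    using that full_trans_mult_apply by simp
  then have "im n t = e ` im n s"
    by (auto simp: im_def image_image)
  then show im: "e ` B = A"
    using eval_elt[OF R m P g B] eval_elt[OF R m P h A] by (simp add: s_def t_def)
  have "finite B" "card B = m" "card A = m"
    using A B finite_subset[of B "{1..n}"] by (auto simp: Subs_def)
  then show "inj_on e B"
    using im by (intro eq_card_imp_inj_on) simp_all
qed

text \<open>The defining equation evaluates to a factorisation of a map \<open>t\<close> with kernel \<open>Q\<close> into \<open>e\<close>
  followed by a map \<open>s\<close> with kernel \<open>P\<close>. The classes of \<open>P\<close> are the fibres of \<open>s\<close>, and each of them
  meets the image of \<open>e\<close> because \<open>s\<close> and \<open>t\<close> have the same image.\<close>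

lemma act_leftD:
  assumes R: "rees_identification n m \<rho>" and m: "0 < m"
    and e: "e \<in> idempotents (full_trans n)" and act: "act_left n m \<rho> e P Q"
  shows "Q = (\<lambda>C. {x \<in> {1..n}. e x \<in> C}) ` P" and "C \<in> P \<Longrightarrow> e ` {1..n} \<inter> C \<noteq> {}"
proof -
  obtain g h A where P: "P \<in> Part n m" and Q: "Q \<in> Part n m" and A: "A \<in> Subs n m"
    and g: "g \<in> carrier (Gmax n \<rho>)" and h: "h \<in> carrier (Gmax n \<rho>)"
    and eq: "overline n e \<otimes>\<^bsub>IGT n\<^esub> elt \<rho> P g A = elt \<rho> Q h A"
    using act by (auto simp: act_left_def)
  define s where "s = ig_eval (full_trans n) (elt \<rho> P g A)"
  define t where "t = ig_eval (full_trans n) (elt \<rho> Q h A)"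
  have s: "ker n s = P" "im n s = A" and t: "ker n t = Q" "im n t = A"
    using eval_elt[OF R m P g A] eval_elt[OF R m Q h A] by (simp_all add: s_def t_def)
  have "t = e \<otimes>\<^bsub>full_trans n\<^esub> s"
    using eval_mult[OF overline_carrier[OF e] elt_carrier[OF R P g A]] eq eval_overline[OF e]
    by (simp add: s_def t_def)
  then have ts: "t x = s (e x)" if "x \<in> {1..n}" for x
    using that full_trans_mult_apply by simp
  have cl: "e x \<in> {1..n}" if "x \<in> {1..n}" for x
    using e that full_trans_apply[of e n x] by (simp add: idempotent_full_trans_iff)
  have P': "P = (\<lambda>y. {x \<in> {1..n}. s x = y}) ` A"
    unfolding s(1)[symmetric] s(2)[symmetric] by (auto simp: ker_def)
  have Q': "Q = (\<lambda>y. {x \<in> {1..n}. t x = y}) ` A"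
    unfolding t(1)[symmetric] t(2)[symmetric] by (auto simp: ker_def)
  have "{x \<in> {1..n}. t x = y} = {x \<in> {1..n}. e x \<in> {x \<in> {1..n}. s x = y}}" for y
    using ts cl by fastforce
  then show "Q = (\<lambda>C. {x \<in> {1..n}. e x \<in> C}) ` P"
    unfolding P' Q' image_image by simp
  show "e ` {1..n} \<inter> C \<noteq> {}" if C: "C \<in> P"
  proof -
    obtain y where y: "y \<in> A" "C = {x \<in> {1..n}. s x = y}"
      using C P' by blast
    obtain z where z: "z \<in> {1..n}" "y = t z"
      using y(1) t(2) by (auto simp: im_def)
    then have "e z \<in> C" using y(2) ts[OF z(1)] cl[OF z(1)] by simp
    then show ?thesis using z(1) by blast
  qed
qed


section \<open>Stationary vertices are isolated\<close>

text \<open>Each point lies in the image of \<open>e\<close>: it belongs to \<open>A\<close> or forms a class of its own, and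
  the image meets that class.\<close>

lemma stationary_forward_identity:
  assumes "stationary_vertex (A, P)" and "\<Union>P = {1..n}"
    and "e \<in> idempotents (full_trans n)" and "A \<subseteq> e ` {1..n}"
    and "\<And>C. C \<in> P \<Longrightarrow> e ` {1..n} \<inter> C \<noteq> {}" and "x \<in> {1..n}"
  shows "e x = x"
proof -
  have "y \<in> e ` {1..n}" if y: "y \<in> {1..n}" for y
  proof -
    obtain C where C: "C \<in> P" "y \<in> C" using y assms(2) by blast
    show ?thesis
    proof (cases "C \<subseteq> A")
      case True
      then show ?thesis using C assms(4) by blast
    next
      case False
      then have "C = {y}"
        using C assms(1) by (auto simp: stationary_vertex_def is_singleton_def)
      then show ?thesis using assms(5)[OF C(1)] by blast
    qed
  qed
  then show ?thesis
    using idempotent_full_trans_identity assms by blast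
qed

text \<open>The classes of \<open>Q\<close> are inverse images under \<open>e\<close>, so \<open>e\<close> can only identify points in a common
  class. A class with two points is contained in \<open>B\<close>, where \<open>e\<close> is injective.\<close>

lemma stationary_backward_identity:
  assumes "stationary_vertex (B, Q)" and "\<Union>Q = {1..n}"
    and "e \<in> idempotents (full_trans n)" and "inj_on e B"
    and Q: "Q = (\<lambda>C. {x \<in> {1..n}. e x \<in> C}) ` P" and "x \<in> {1..n}"
  shows "e x = x"
proof -
  have "inj_on e {1..n}"
  proof (rule inj_onI)
    fix y z assume yz: "y \<in> {1..n}" "z \<in> {1..n}" "e y = e z"
    obtain C where C: "C \<in> Q" "y \<in> C" using yz assms(2) by blast
    then have z: "z \<in> C" using yz Q by auto
    show "y = z"
    proof (cases "C \<subseteq> B")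
      case True
      then show ?thesis using C z yz assms(4) by (meson inj_onD subsetD)
    next
      case False
      then show ?thesis
        using C z assms(1) by (auto simp: stationary_vertex_def is_singleton_def)
    qed
  qed
  then show ?thesis
    using idempotent_full_trans_identity assms by blast
qed

lemma stationary_edge:
  assumes Rm: "rees_identification n m (\<rho> m)" and Rr: "rees_identification n r (\<rho> r)"
    and m: "0 < m" and r: "0 < r"
    and edge: "contact_edge n \<rho> m r v g w"
    and stat: "stationary_vertex v \<or> stationary_vertex w"
  shows "v = w \<and> g = \<one>\<^bsub>label_group n \<rho> m r\<^esub>"
  using edge
proof cases
  case (1 e B A P Q P\<^sub>0 A\<^sub>0 a b)
  note right = act_rightD[OF Rm m 1(4,5)]
  note left = act_leftD[OF Rr r 1(4,6)]
  have P: "P \<in> Part n r" and Q: "Q \<in> Part n r" using 1(6) by (simp_all add: act_left_def)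
  have A: "A \<in> Subs n m" and B: "B \<in> Subs n m" using 1(5) by (simp_all add: act_right_def)
  have UP: "\<Union>P = {1..n}" and UQ: "\<Union>Q = {1..n}" and Bn: "B \<subseteq> {1..n}"
    using P Q B by (auto simp: Part_def partition_on_def Subs_def)
  have fixed: "e x = x" if x: "x \<in> {1..n}" for x
    using stat
  proof
    assume "stationary_vertex v"
    then have "stationary_vertex (A, P)" using 1(1) by simp
    then show ?thesis
      using stationary_forward_identity[OF _ UP 1(4) _ left(2) x] right(1) Bn by blast
  next
    assume "stationary_vertex w"
    then have "stationary_vertex (B, Q)" using 1(3) by simp
    then show ?thesis
      using stationary_backward_identity[OF _ UQ 1(4) right(2) left(1) x] by blast
  qed
  have "e ` B = id ` B" by (rule image_cong) (use fixed Bn in auto)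
  then have AB: "A = B" using right(1) by simp
  have "{x \<in> {1..n}. e x \<in> C} = C" if C: "C \<in> P" for C
  proof -
    have "C \<subseteq> {1..n}" using C UP by blast
    moreover have "{x \<in> {1..n}. e x \<in> C} = {x \<in> {1..n}. x \<in> C}"
      using fixed by (metis (lifting))
    ultimately show ?thesis by blast
  qed
  then have PQ: "Q = P" using left(1) by simp
  \<comment> \<open>Since \<open>A = B\<close> and \<open>P = Q\<close>, each label is a product of an entry and its inverse.\<close>
  interpret Gm: group "Gmax n (\<rho> m)" by (rule group_Gmax[OF Rm])
  interpret Gr: group "Gmax n (\<rho> r)" by (rule group_Gmax[OF Rr])
  have "P\<^sub>0 \<in> Part n m" using 1(7) by (simp add: act_left_def)
  then have "fent (\<rho> m) P\<^sub>0 A \<in> carrier (Gmax n (\<rho> m))"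
    using fent_closed[OF Rm] A 1 by blast
  moreover have "A\<^sub>0 \<in> Subs n r" using 1(10) by (simp add: act_right_def)
  then have "fent (\<rho> r) P A\<^sub>0 \<in> carrier (Gmax n (\<rho> r))"
    using fent_closed[OF Rr] P 1 by blast
  ultimately show ?thesis
    using 1 AB PQ by (simp add: label_group_def DirProd_def)
qed

lemma stationary_walk:
  assumes Rm: "rees_identification n m (\<rho> m)" and Rr: "rees_identification n r (\<rho> r)"
    and m: "0 < m" and r: "0 < r"
    and walk: "contact_walk n \<rho> m r v g w" and stat: "stationary_vertex v"
  shows "w = v \<and> g = \<one>\<^bsub>label_group n \<rho> m r\<^esub>"
proof -
  interpret L: group "label_group n \<rho> m r"
    unfolding label_group_def by (intro DirProd_group group_Gmax[OF Rm] group_Gmax[OF Rr])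
  note edge = stationary_edge[OF Rm Rr m r]
  show ?thesis
    using walk stat
  proof induction
    case (forward u g v h w)
    then show ?case using edge[of v h w] by auto
  next
    case (backward u g v w h)
    then show ?case using edge[of w h v] by auto
  qed simp
qed


section \<open>Non-regular vertices when \<open>m\<close> or \<open>r\<close> is \<open>n - 1\<close>\<close>

text \<open>If \<open>A\<close> met every class of \<open>P\<close>, it would also contain all singleton classes, hence all
  points. If it met every class in at most one point, all classes would be singletons. Both are
  excluded by \<open>m < n\<close> and \<open>r < n\<close>.\<close>

lemma stationary_imp_nonregular:
  assumes A: "A \<in> Subs n m" "m < n" and P: "P \<in> Part n r" "r < n"
    and stat: "stationary_vertex (A, P)"
  shows "\<not> regular_vertex (A, P)"
proof -
  have part: "partition_on {1..n} P" "card P = r" and sub: "A \<subseteq> {1..n}" "card A = m"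
    using A P by (auto simp: Part_def Subs_def)
  have UP: "\<Union>P = {1..n}" using part by (simp add: partition_on_def)
  have "\<not> saturates A P"
  proof
    assume sat: "saturates A P"
    have "{1..n} \<subseteq> A"
    proof
      fix x assume "x \<in> {1..n}"
      then obtain C where C: "C \<in> P" "x \<in> C" using UP by blast
      obtain y where "y \<in> A" "y \<in> C" using sat C(1) by (auto simp: saturates_def)
      then show "x \<in> A"
        using C stat by (auto simp: stationary_vertex_def is_singleton_def)
    qed
    then show False using sub A(2) card_mono[of A "{1..n}"] finite_subset[of A "{1..n}"] by auto
  qed
  moreover have "\<not> separates P A"
  proof
    assume sep: "separates P A"
    have sing: "\<exists>x. C = {x}" if "C \<in> P" for C
    proof (cases "C \<subseteq> A")
      case True
      moreover have "C \<noteq> {}" using part that by (auto simp: partition_on_def)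
      ultimately show ?thesis using sep that unfolding separates_def by blast
    next
      case False
      then show ?thesis using that stat by (auto simp: stationary_vertex_def is_singleton_def)
    qed
    have "(\<lambda>x. {x}) ` {1..n} \<subseteq> P"
      using sing UP by (metis (no_types, lifting) UnionE image_subsetI singletonD)
    moreover have "finite P" using part finite_elements by blast
    ultimately have "card ((\<lambda>x. {x}) ` {1..n}) \<le> r"
      using card_mono part by metis
    then show False using P(2) by (simp add: card_image)
  qed
  ultimately show ?thesis by (simp add: regular_vertex_def)
qed

text \<open>A non-regular vertex has a class \<open>C\<close> disjoint from \<open>A\<close> and a class \<open>D\<close> with two points of
  \<open>A\<close>. If \<open>A\<close> misses one point only, this point alone makes up \<open>C\<close>, the only class not contained in
  \<open>A\<close>. If \<open>P\<close> has \<open>n - 1\<close> classes, \<open>D\<close> consists of these two points and all other classes are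
  singletons.\<close>

lemma nonregular_imp_stationary:
  assumes A: "A \<in> Subs n m" "m < n" and P: "P \<in> Part n r" "r < n"
    and corank: "m = n - 1 \<or> r = n - 1"
    and nonreg: "\<not> regular_vertex (A, P)"
  shows "stationary_vertex (A, P)"
proof -
  have part: "partition_on {1..n} P" "card P = r" and sub: "A \<subseteq> {1..n}" "card A = m"
    using A P by (auto simp: Part_def Subs_def)
  have UP: "\<Union>P = {1..n}" using part by (simp add: partition_on_def)
  have class_eq: "E = F" if "E \<in> P" "F \<in> P" "u \<in> E" "u \<in> F" for E F u
    using part(1) that by (auto simp: partition_on_def disjoint_def)
  obtain C where C: "C \<in> P" "A \<inter> C = {}"
    using nonreg by (auto simp: regular_vertex_def saturates_def)
  obtain D x y where D: "D \<in> P" "x \<in> A \<inter> D" "y \<in> A \<inter> D" "x \<noteq> y"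
    using nonreg by (auto simp: regular_vertex_def separates_def)
  from corank show ?thesis
  proof
    assume "m = n - 1"
    then have "card ({1..n} - A) = 1"
      using sub A(2) finite_subset[of A "{1..n}"] by (simp add: card_Diff_subset)
    then obtain z where z: "{1..n} - A = {z}" by (auto simp: card_1_singleton_iff)
    have Cz: "C = {z}"
    proof -
      have "C \<noteq> {}" "C \<subseteq> {1..n} - A" using C part(1) by (auto simp: partition_on_def)
      then show ?thesis using z by auto
    qed
    have "is_singleton E" if E: "E \<in> P" "\<not> E \<subseteq> A" for E
    proof -
      obtain w where w: "w \<in> E" "w \<notin> A" using E by blast
      then have "w \<in> {1..n} - A" using E UP by blast
      then have "z \<in> E" using w unfolding z by blast
      moreover have "z \<in> C" using Cz by simp
      ultimately have "E = C" using class_eq[OF E(1) C(1)] by blast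
      then show ?thesis using Cz by simp
    qed
    then show ?thesis by (simp add: stationary_vertex_def)
  next
    assume "r = n - 1"
    define cl where "cl u = (THE E. E \<in> P \<and> u \<in> E)" for u
    have cl: "cl u = E" if "E \<in> P" "u \<in> E" for u E
      unfolding cl_def using class_eq that by (intro the_equality) blast+
    have xn: "x \<in> {1..n}" using D sub by blast
    \<comment> \<open>Discarding \<open>x\<close> loses no class, since \<open>y\<close> also represents \<open>D\<close>; hence the remaining \<open>n - 1\<close>
      points represent the \<open>n - 1\<close> classes bijectively.\<close>
    have "cl ` ({1..n} - {x}) = P"
    proof
      show "cl ` ({1..n} - {x}) \<subseteq> P"
      proof
        fix E assume "E \<in> cl ` ({1..n} - {x})"
        then obtain u where u: "u \<in> {1..n}" "E = cl u" by blast
        then obtain F where "F \<in> P" "u \<in> F" using UP by blast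
        then show "E \<in> P" using cl u by simp
      qed
      show "P \<subseteq> cl ` ({1..n} - {x})"
      proof
        fix E assume E: "E \<in> P"
        then have "E \<noteq> {}" using part(1) by (auto simp: partition_on_def)
        then obtain u where u: "u \<in> E" by blast
        have "\<exists>v\<in>E. v \<noteq> x"
        proof (cases "u = x")
          case True
          then have "E = D" using class_eq[OF E D(1) u] D(2) by simp
          then have "y \<in> E" using D(3) by simp
          then show ?thesis using D(4) by fast
        qed (use u in blast)
        then obtain v where v: "v \<in> E" "v \<noteq> x" by blast
        then have "v \<in> {1..n} - {x}" "cl v = E" using UP E cl by blast+
        then show "E \<in> cl ` ({1..n} - {x})" by blast
      qed
    qed
    then have inj: "inj_on cl ({1..n} - {x})"
      using part(2) \<open>r = n - 1\<close> xn by (intro eq_card_imp_inj_on) simp_all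
    have same: "u = v" if "E \<in> P" "u \<in> E" "v \<in> E" "u \<noteq> x" "v \<noteq> x" for E u v
    proof -
      have "u \<in> {1..n}" "v \<in> {1..n}" using that(1-3) UP by blast+
      moreover have "cl u = cl v" using cl[OF that(1,2)] cl[OF that(1,3)] by simp
      ultimately show ?thesis using that(4,5) by (intro inj_onD[OF inj]) auto
    qed
    have "D \<subseteq> A"
    proof
      fix u assume u: "u \<in> D"
      show "u \<in> A"
      proof (cases "u = x")
        case False
        then have "u = y" using same[OF D(1) u, of y] D by blast
        then show ?thesis using D by blast
      qed (use D in blast)
    qed
    have "is_singleton E" if E: "E \<in> P" "\<not> E \<subseteq> A" for E
    proof -
      obtain u where u: "u \<in> E" "u \<notin> A" using E by blast
      have "x \<notin> E" using class_eq[OF E(1) D(1)] D(2) E(2) \<open>D \<subseteq> A\<close> by blast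
      then have "v = u" if "v \<in> E" for v using same[OF E(1) that u(1)] u(1) that by blast
      then have "E = {u}" using u(1) by blast
      then show ?thesis by simp
    qed
    then show ?thesis by (simp add: stationary_vertex_def)
  qed
qed

theorem proposition3p6:
  fixes n m r :: nat and \<rho> :: "nat \<Rightarrow> rees_data"
    and A :: "nat set" and P :: "nat set set"
  assumes "0 < n" and "0 < m" and "0 < r" and "m \<le> n - 1" and "r \<le> n - 1"
    and "m = n - 1 \<or> r = n - 1"
    and "\<And>k. k \<in> {m, r} \<Longrightarrow> rees_identification n k (\<rho> k)"
    and "(A, P) \<in> contact_vertices n m r"
  shows "(\<not> regular_vertex (A, P) \<longleftrightarrow> stationary_vertex (A, P)) \<and>
         (\<not> regular_vertex (A, P) \<longrightarrow>
            vertex_group n \<rho> m r (A, P) = {\<one>\<^bsub>label_group n \<rho> m r\<^esub>})"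
proof -
  have A: "A \<in> Subs n m" "m < n" and P: "P \<in> Part n r" "r < n"
    using assms by (auto simp: contact_vertices_def)
  have eq: "\<not> regular_vertex (A, P) \<longleftrightarrow> stationary_vertex (A, P)"
    using stationary_imp_nonregular[OF A P] nonregular_imp_stationary[OF A P assms(6)] by blast
  have "vertex_group n \<rho> m r (A, P) = {\<one>\<^bsub>label_group n \<rho> m r\<^esub>}"
    if "stationary_vertex (A, P)"
  proof
    show "vertex_group n \<rho> m r (A, P) \<subseteq> {\<one>\<^bsub>label_group n \<rho> m r\<^esub>}"
      using stationary_walk[of n m \<rho> r "(A, P)", OF _ _ assms(2,3) _ that] assms(7)
      by (auto simp: vertex_group_def)
    show "{\<one>\<^bsub>label_group n \<rho> m r\<^esub>} \<subseteq> vertex_group n \<rho> m r (A, P)"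
      using assms(8) by (auto simp: vertex_group_def intro: contact_walk.empty)
  qed
  then show ?thesis using eq by blast
qed

end
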